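(* Let $d\in\mathbb N$, $\beta>0$ and $a>0$. For $\varrho>0$, the free energy of the PMF model, defined as the Legendre–Fenchel transform of the pressure, satisfies $$f^{\mathrm{PMF}}(\beta,\varrho):=\sup_{\mu\in\mathbb R,\ \alpha\le0}\big\{(\mu+\alpha)\varrho-p^{\mathrm{PMF}}(\beta,\alpha,\mu)\big\}=f(\beta,\varrho)+\frac a2\varrho^2.$$
   Context: For $\alpha\le 0$ and $k\in\mathbb N=\{1,2,\dots\}$: $q_k^{(\alpha)}=\frac{e^{\beta k\alpha}}{(4\pi\beta)^{d/2}k^{1+d/2}}$, $\bar q^{(\alpha)}=\sum_kq_k^{(\alpha)}$. The ideal-gas pressure is $p(\beta,\alpha)=\bar q^{(\alpha)}/\beta$ for $\alpha\le0$ and $+\infty$ for $\alpha>0$, and the ideal-gas free energy is $f(\beta,\varrho)=\sup_{s\in\mathbb R}\{s\varrho-p(\beta,s)\}$. $\ell_1(\mathbb R_+)$ is the space of nonnegative summable real sequences and $D(x)=\sum_{k\ge1}kx_k\in[0,\infty]$. Define $$I_\alpha(x)=\sum_{k=1}^\infty\frac{x_k}{\beta}\Big(\log\frac{x_k}{q_k^{(\alpha)}}-1\Big)+\frac{\bar q^{(\alpha)}}{\beta}\ (0\log0=0),\qquad H^{\mathrm{PMF}}_{\mu,\mathrm{lsc}}(x)=\begin{cases}-\mu D(x)+\frac a2D(x)^2,&D(x)\ge\mu/a,\\-\frac{\mu^2}{2a},&D(x)<\mu/a\end{cases}$$ ($=+\infty$ if $D(x)=\infty$). The limiting pressure of the PMF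 model is given by its large deviation variational formula $$p^{\mathrm{PMF}}(\beta,\alpha,\mu)=\frac{\bar q^{(\alpha)}}\beta-\inf_{y\in\ell_1(\mathbb R_+)}\big\{I_\alpha(y)+H^{\mathrm{PMF}}_{\mu,\mathrm{lsc}}(y)\big\}.$$ *)

theory Defs
  imports "HOL-Library.Extended_Real"
begin

text \<open>
  Sequences indexed by \<open>{1, 2, \<dots>}\<close> are functions on \<^typ>\<open>nat\<close>; sums over \<open>k \<ge> 1\<close> are
  written with \<^const>\<open>Suc\<close>. Quantities that may be infinite live in \<^typ>\<open>ereal\<close>.
\<close>

definition q :: "nat \<Rightarrow> real \<Rightarrow> real \<Rightarrow> nat \<Rightarrow> real" where
  "q d \<beta> \<alpha> k =
     exp (\<beta> * real k * \<alpha>) /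
       ((4 * pi * \<beta>) powr (real d / 2) * real k powr (1 + real d / 2))"

definition qbar :: "nat \<Rightarrow> real \<Rightarrow> real \<Rightarrow> real" where
  "qbar d \<beta> \<alpha> = (\<Sum>k. q d \<beta> \<alpha> (Suc k))"

definition pressure :: "nat \<Rightarrow> real \<Rightarrow> real \<Rightarrow> ereal" where
  "pressure d \<beta> \<alpha> = (if \<alpha> \<le> 0 then ereal (qbar d \<beta> \<alpha> / \<beta>) else \<infinity>)"

definition free_energy :: "nat \<Rightarrow> real \<Rightarrow> real \<Rightarrow> ereal" where
  "free_energy d \<beta> \<rho> = (SUP s::real. ereal (s * \<rho>) - pressure d \<beta> s)"

text \<open>The unused entry at index 0 is normalised to 0.\<close>

definition l1_nonneg :: "(nat \<Rightarrow> real) set" where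
  "l1_nonneg = {x. x 0 = 0 \<and> (\<forall>k. 0 \<le> x k) \<and> summable x}"

definition D :: "(nat \<Rightarrow> real) \<Rightarrow> ereal" where
  "D x = (\<Sum>k. ereal (real (Suc k) * x (Suc k)))"

text \<open>
  The series below is taken in \<^typ>\<open>ereal\<close>: for \<open>x \<ge> 0\<close> its \<open>k\<close>-th term is at least
  \<open>- q\<^sub>k / \<beta>\<close>, which is summable when \<open>d \<ge> 1\<close> and \<open>\<alpha> \<le> 0\<close>, so the partial sums converge
  to a real number or to \<open>\<infinity>\<close>. The convention \<open>0 log 0 = 0\<close> holds because of the factor
  \<open>x k / \<beta>\<close>.
\<close>

definition I_rate :: "nat \<Rightarrow> real \<Rightarrow> real \<Rightarrow> (nat \<Rightarrow> real) \<Rightarrow> ereal" where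
  "I_rate d \<beta> \<alpha> x =
     (\<Sum>k. ereal (x (Suc k) / \<beta> * (ln (x (Suc k) / q d \<beta> \<alpha> (Suc k)) - 1)))
       + ereal (qbar d \<beta> \<alpha> / \<beta>)"

definition H_PMF_lsc :: "real \<Rightarrow> real \<Rightarrow> (nat \<Rightarrow> real) \<Rightarrow> ereal" where
  "H_PMF_lsc a \<mu> x =
     (if D x = \<infinity> then \<infinity>
      else if D x \<ge> ereal (\<mu> / a) then - (ereal \<mu> * D x) + ereal (a / 2) * (D x)\<^sup>2
      else ereal (- (\<mu>\<^sup>2 / (2 * a))))"

definition pressure_PMF :: "nat \<Rightarrow> real \<Rightarrow> real \<Rightarrow> real \<Rightarrow> real \<Rightarrow> ereal" where
  "pressure_PMF d \<beta> a \<alpha> \<mu> =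
     ereal (qbar d \<beta> \<alpha> / \<beta>) - (INF y\<in>l1_nonneg. I_rate d \<beta> \<alpha> y + H_PMF_lsc a \<mu> y)"

definition free_energy_PMF :: "nat \<Rightarrow> real \<Rightarrow> real \<Rightarrow> real \<Rightarrow> ereal" where
  "free_energy_PMF d \<beta> a \<rho> =
     (SUP (\<mu>, \<alpha>) \<in> UNIV \<times> {..0}. ereal ((\<mu> + \<alpha>) * \<rho>) - pressure_PMF d \<beta> a \<alpha> \<mu>)"

end

theory Submission
  imports Defs "HOL-Analysis.Extended_Real_Limits" "HOL-Analysis.Summation_Tests"
begin

text \<open>
  Completing the square gives \<open>H \<ge> -\<mu>\<^sup>2 / (2a)\<close>, and Gibbs' inequality
  \<open>y (log (y / q) - 1) \<ge> -q\<close>, summed over the cycle lengths, gives \<open>I\<^sub>\<alpha> \<ge> 0\<close>. Hence the pressure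
  of the PMF model is at most \<open>qbar\<^sub>\<alpha> / \<beta> + \<mu>\<^sup>2 / (2a)\<close>, and taking \<open>\<alpha> = s \<le> 0\<close> and
  \<open>\<mu> = a\<rho>\<close> in the Legendre transform yields \<open>s\<rho> - qbar\<^sub>s / \<beta> + a\<rho>\<^sup>2 / 2\<close>. The supremum over
  \<open>s\<close> is the inequality \<open>\<ge>\<close>; positive \<open>s\<close> do not contribute, the ideal pressure being infinite
  there.

  For \<open>\<le>\<close> a single trial sequence, independent of \<open>(\<mu>, \<alpha>)\<close>, is inserted into the variational
  formula, namely the ideal-gas weights \<open>y = q\<^sup>(\<^sup>s\<^sup>)\<close>, for which
  \<open>I\<^sub>\<alpha>(y) = (s - \<alpha>) D(y) - qbar\<^sub>s / \<beta> + qbar\<^sub>\<alpha> / \<beta>\<close>. Here \<open>s \<le> 0\<close> is the maximiser for the ideal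
  gas: either the density \<open>D(y)\<close> equals \<open>\<rho>\<close>, or \<open>\<rho>\<close> exceeds the critical density, \<open>s = 0\<close> and
  \<open>D(y) \<le> \<rho>\<close> (lemma \<open>ideal_gas_density\<close>). The excess of the \<open>(\<mu>, \<alpha>)\<close> term over
  \<open>s\<rho> - qbar\<^sub>s / \<beta> + a\<rho>\<^sup>2 / 2\<close> is then at most
  \<open>(\<alpha> - s) (\<rho> - D(y)) + (\<mu>\<rho> + H(D(y)) - a\<rho>\<^sup>2 / 2)\<close>. The first summand is \<open>\<le> 0\<close> in both cases.
  The second is \<open>\<le> 0\<close> because \<open>H\<close>, in contrast to \<open>-\<mu>D + aD\<^sup>2 / 2\<close>, is nondecreasing in \<open>D\<close>;
  thus the trial sequence may leave out the condensate density \<open>\<rho> - D(y)\<close>.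
\<close>

section \<open>Ideal-gas weights\<close>

lemma q_0 [simp]: "q d \<beta> \<alpha> 0 = 0"
  by (simp add: q_def)

lemma q_pos: "\<beta> > 0 \<Longrightarrow> k > 0 \<Longrightarrow> q d \<beta> \<alpha> k > 0"
  by (simp add: q_def)

lemma q_nonneg: "q d \<beta> \<alpha> k \<ge> 0"
  by (simp add: q_def)

lemma q_shift: "q d \<beta> \<alpha> k = exp (\<beta> * (\<alpha> - s) * real k) * q d \<beta> s k"
  by (simp add: q_def algebra_simps flip: exp_add)

lemma summable_q:
  assumes "d \<ge> 1" "\<beta> > 0" "\<alpha> \<le> 0"
  shows "summable (q d \<beta> \<alpha>)"
proof (rule summable_comparison_test')
  have "summable (\<lambda>k. real k powr (- (1 + real d / 2)))"
    using assms by (subst summable_real_powr_iff) auto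
  then show "summable (\<lambda>k. inverse ((4 * pi * \<beta>) powr (real d / 2)) * real k powr (- (1 + real d / 2)))"
    by (rule summable_mult)
next
  fix k :: nat
  have "exp (\<beta> * real k * \<alpha>) \<le> 1"
    using assms by (simp add: mult_nonneg_nonpos)
  then have "q d \<beta> \<alpha> k \<le> 1 / ((4 * pi * \<beta>) powr (real d / 2) * real k powr (1 + real d / 2))"
    unfolding q_def by (intro divide_right_mono) auto
  also have "\<dots> = inverse ((4 * pi * \<beta>) powr (real d / 2)) * real k powr (- (1 + real d / 2))"
    by (subst powr_minus) (simp add: field_simps)
  finally show "norm (q d \<beta> \<alpha> k) \<le> inverse ((4 * pi * \<beta>) powr (real d / 2)) * real k powr (- (1 + real d / 2))"
    using q_nonneg[of d \<beta> \<alpha> k] by simp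
qed

lemma q_sums_qbar:
  assumes "d \<ge> 1" "\<beta> > 0" "\<alpha> \<le> 0"
  shows "(\<lambda>k. q d \<beta> \<alpha> (Suc k)) sums qbar d \<beta> \<alpha>"
  unfolding qbar_def using summable_q[OF assms] by (simp add: summable_Suc_iff summable_sums)

section \<open>Lower bounds for the rate function and the energy\<close>

text \<open>Gibbs' inequality: with \<open>t = y / q\<close> it reads \<open>ln (1 / t) \<le> 1 / t - 1\<close>.\<close>

lemma entropy_ge:
  fixes y q :: real
  assumes "y \<ge> 0" "q > 0"
  shows "y * (ln (y / q) - 1) \<ge> - q"
proof (cases "y = 0")
  case False
  with assms have "y > 0" by simp
  with assms have "ln (q / y) \<le> q / y - 1"
    by (intro ln_le_minus_one) simp
  moreover have "ln (y / q) = - ln (q / y)"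
    using \<open>y > 0\<close> assms by (simp add: ln_div)
  ultimately have "ln (y / q) - 1 \<ge> - (q / y)" by simp
  then have "y * (ln (y / q) - 1) \<ge> y * - (q / y)"
    using \<open>y > 0\<close> by (intro mult_left_mono) auto
  then show ?thesis using \<open>y > 0\<close> by simp
qed (use assms in simp)

text \<open>
  Adding the summable series of the \<open>q\<^sub>k / \<beta>\<close> makes all terms nonnegative, so the extended-real
  series has a limit, which is possibly \<open>\<infinity>\<close>; this is what allows the constant
  \<open>qbar / \<beta>\<close> to be distributed over the terms.
\<close>

lemma I_rate_nonneg:
  assumes "d \<ge> 1" "\<beta> > 0" "\<alpha> \<le> 0" and y: "\<And>k. 0 \<le> y k"
  shows "I_rate d \<beta> \<alpha> y \<ge> 0"
proof -
  define t where "t k = y (Suc k) / \<beta> * (ln (y (Suc k) / q d \<beta> \<alpha> (Suc k)) - 1)" for k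
  define g where "g k = q d \<beta> \<alpha> (Suc k) / \<beta>" for k
  have nonneg: "0 \<le> t k + g k" for k
  proof -
    have "- q d \<beta> \<alpha> (Suc k) \<le> y (Suc k) * (ln (y (Suc k) / q d \<beta> \<alpha> (Suc k)) - 1)"
      using y q_pos[OF \<open>\<beta> > 0\<close>] by (intro entropy_ge) auto
    from divide_right_mono[OF this, of \<beta>] show ?thesis
      using \<open>\<beta> > 0\<close> by (simp add: t_def g_def)
  qed
  have g: "(\<lambda>k. ereal (g k)) sums ereal (qbar d \<beta> \<alpha> / \<beta>)"
    unfolding sums_ereal g_def using q_sums_qbar[OF assms(1-3)] by (rule sums_divide)
  define S where "S = (\<Sum>k. ereal (t k + g k))"
  have S: "(\<lambda>k. ereal (t k + g k)) sums S"
    unfolding S_def using nonneg by (intro summable_sums summable_ereal_pos) simp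
  have "S \<ge> 0"
    unfolding S_def using nonneg by (intro suminf_0_le) simp
  have "(\<lambda>n. (\<Sum>k<n. ereal (t k + g k)) + (\<Sum>k<n. ereal (- g k)))
      \<longlonglongrightarrow> S + ereal (- (qbar d \<beta> \<alpha> / \<beta>))"
  proof (rule tendsto_add_ereal_general1)
    show "\<bar>ereal (- (qbar d \<beta> \<alpha> / \<beta>))\<bar> \<noteq> \<infinity>" by simp
    show "(\<lambda>n. \<Sum>k<n. ereal (t k + g k)) \<longlonglongrightarrow> S"
      using S by (simp add: sums_def)
    have "(\<lambda>k. ereal (- g k)) sums ereal (- (qbar d \<beta> \<alpha> / \<beta>))"
      using g unfolding sums_ereal by (rule sums_minus)
    then show "(\<lambda>n. \<Sum>k<n. ereal (- g k)) \<longlonglongrightarrow> ereal (- (qbar d \<beta> \<alpha> / \<beta>))"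
      by (simp add: sums_def)
  qed
  then have "(\<lambda>k. ereal (t k)) sums (S + ereal (- (qbar d \<beta> \<alpha> / \<beta>)))"
    by (simp add: sums_def sum.distrib sum_negf)
  then have "I_rate d \<beta> \<alpha> y = S + ereal (- (qbar d \<beta> \<alpha> / \<beta>)) + ereal (qbar d \<beta> \<alpha> / \<beta>)"
    unfolding I_rate_def t_def[symmetric] by (simp only: sums_unique[symmetric])
  also have "\<dots> = S" by (cases S) auto
  finally show ?thesis using \<open>S \<ge> 0\<close> by simp
qed

lemma complete_square_ge:
  fixes a m r :: real
  assumes "a > 0"
  shows "- (m\<^sup>2 / (2 * a)) \<le> - (m * r) + a / 2 * r\<^sup>2"
proof -
  have "- (m * r) + a / 2 * r\<^sup>2 + m\<^sup>2 / (2 * a) = (a * r - m)\<^sup>2 / (2 * a)"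
    using assms by (simp add: field_simps power2_eq_square)
  also have "\<dots> \<ge> 0" using assms by simp
  finally show ?thesis by simp
qed

lemma H_PMF_lsc_ge:
  assumes "a > 0"
  shows "H_PMF_lsc a \<mu> y \<ge> ereal (- (\<mu>\<^sup>2 / (2 * a)))"
  using complete_square_ge[OF assms, of \<mu>] by (cases "D y") (auto simp: H_PMF_lsc_def)

lemma pressure_PMF_le:
  assumes "d \<ge> 1" "\<beta> > 0" "a > 0" "\<alpha> \<le> 0"
  shows "pressure_PMF d \<beta> a \<alpha> \<mu> \<le> ereal (qbar d \<beta> \<alpha> / \<beta> + \<mu>\<^sup>2 / (2 * a))"
proof -
  have "ereal (- (\<mu>\<^sup>2 / (2 * a))) \<le> (INF y\<in>l1_nonneg. I_rate d \<beta> \<alpha> y + H_PMF_lsc a \<mu> y)"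
  proof (rule INF_greatest)
    fix y assume "y \<in> l1_nonneg"
    then have "I_rate d \<beta> \<alpha> y \<ge> 0"
      using assms by (intro I_rate_nonneg) (auto simp: l1_nonneg_def)
    from add_mono[OF this H_PMF_lsc_ge[OF \<open>a > 0\<close>]]
    show "ereal (- (\<mu>\<^sup>2 / (2 * a))) \<le> I_rate d \<beta> \<alpha> y + H_PMF_lsc a \<mu> y" by simp
  qed
  then have "pressure_PMF d \<beta> a \<alpha> \<mu> \<le> ereal (qbar d \<beta> \<alpha> / \<beta>) - ereal (- (\<mu>\<^sup>2 / (2 * a)))"
    unfolding pressure_PMF_def by (intro ereal_minus_mono) auto
  then show ?thesis by simp
qed

section \<open>Ideal-gas weights as trial sequences\<close>

lemma D_eq:
  assumes "(\<lambda>k. real k * y k) sums r"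
  shows "D y = ereal r"
proof -
  have "(\<lambda>k. real (Suc k) * y (Suc k)) sums r"
    using assms by (subst sums_Suc_iff) simp
  then show ?thesis
    unfolding D_def by (simp only: sums_ereal sums_unique[symmetric])
qed

text \<open>The logarithm is linear in \<open>k\<close>, so the entropy reduces to a multiple of the density.\<close>

lemma I_rate_q:
  assumes "d \<ge> 1" "\<beta> > 0" "s \<le> 0"
    and r: "(\<lambda>k. real k * q d \<beta> s k) sums r"
  shows "I_rate d \<beta> \<alpha> (q d \<beta> s) = ereal ((s - \<alpha>) * r - qbar d \<beta> s / \<beta> + qbar d \<beta> \<alpha> / \<beta>)"
proof -
  have term_eq: "q d \<beta> s (Suc k) / \<beta> * (ln (q d \<beta> s (Suc k) / q d \<beta> \<alpha> (Suc k)) - 1) =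
      (s - \<alpha>) * (real (Suc k) * q d \<beta> s (Suc k)) - q d \<beta> s (Suc k) / \<beta>" for k
  proof -
    have "q d \<beta> s (Suc k) / q d \<beta> \<alpha> (Suc k) = exp (\<beta> * (s - \<alpha>) * real (Suc k))"
      using q_pos[OF \<open>\<beta> > 0\<close>, of "Suc k" d \<alpha>] by (subst q_shift[of _ _ s _ \<alpha>]) simp
    then show ?thesis
      using \<open>\<beta> > 0\<close> by (simp add: field_simps)
  qed
  have "(\<lambda>k. real (Suc k) * q d \<beta> s (Suc k)) sums r"
    using r by (subst sums_Suc_iff) simp
  then have "(\<lambda>k. (s - \<alpha>) * (real (Suc k) * q d \<beta> s (Suc k)) - q d \<beta> s (Suc k) / \<beta>)
      sums ((s - \<alpha>) * r - qbar d \<beta> s / \<beta>)"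
    using q_sums_qbar[OF assms(1-3)] by (intro sums_diff sums_mult sums_divide)
  then have "(\<Sum>k. ereal (q d \<beta> s (Suc k) / \<beta> * (ln (q d \<beta> s (Suc k) / q d \<beta> \<alpha> (Suc k)) - 1)))
      = ereal ((s - \<alpha>) * r - qbar d \<beta> s / \<beta>)"
    unfolding term_eq by (simp only: sums_ereal sums_unique[symmetric])
  then show ?thesis by (simp add: I_rate_def)
qed

text \<open>
  On \<open>[\<mu> / a, \<infinity>)\<close> the energy is the increasing branch of a parabola, and below it is constant,
  so a density \<open>r \<le> \<rho>\<close> costs no more than \<open>\<rho>\<close>. When the constant branch applies, the claim is
  once more completion of the square.
\<close>

lemma H_PMF_lsc_le:
  assumes "a > 0" "D y = ereal r" "r \<le> \<rho>"
  shows "H_PMF_lsc a \<mu> y \<le> ereal (a / 2 * \<rho>\<^sup>2 - \<mu> * \<rho>)"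
proof (cases "r \<ge> \<mu> / a")
  case True
  have "\<mu> \<le> a * r" using True assms by (simp add: field_simps)
  moreover have "a * r \<le> a * \<rho>" using assms by simp
  ultimately have "0 \<le> (\<rho> - r) * (a * \<rho> + a * r - 2 * \<mu>)"
    using \<open>r \<le> \<rho>\<close> by (intro mult_nonneg_nonneg; linarith)
  then have "- (\<mu> * r) + a / 2 * r\<^sup>2 \<le> a / 2 * \<rho>\<^sup>2 - \<mu> * \<rho>"
    by (simp add: field_simps power2_eq_square)
  then show ?thesis using True assms by (simp add: H_PMF_lsc_def)
next
  case False
  then show ?thesis
    using assms complete_square_ge[OF \<open>a > 0\<close>, of \<mu> \<rho>] by (simp add: H_PMF_lsc_def)
qed

lemma pressure_PMF_ge:
  assumes "d \<ge> 1" "\<beta> > 0" "a > 0" "s \<le> 0"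
    and r: "(\<lambda>k. real k * q d \<beta> s k) sums r" and "r \<le> \<rho>"
  shows "pressure_PMF d \<beta> a \<alpha> \<mu>
    \<ge> ereal ((\<alpha> - s) * r + qbar d \<beta> s / \<beta> + \<mu> * \<rho> - a / 2 * \<rho>\<^sup>2)"
proof -
  have "q d \<beta> s \<in> l1_nonneg"
    using summable_q[of d \<beta> s] assms by (simp add: l1_nonneg_def q_nonneg)
  then have "(INF y\<in>l1_nonneg. I_rate d \<beta> \<alpha> y + H_PMF_lsc a \<mu> y)
      \<le> I_rate d \<beta> \<alpha> (q d \<beta> s) + H_PMF_lsc a \<mu> (q d \<beta> s)"
    by (rule INF_lower)
  also have "\<dots> \<le> ereal ((s - \<alpha>) * r - qbar d \<beta> s / \<beta> + qbar d \<beta> \<alpha> / \<beta>)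
      + ereal (a / 2 * \<rho>\<^sup>2 - \<mu> * \<rho>)"
    using assms I_rate_q[of d \<beta> s r \<alpha>] H_PMF_lsc_le[OF \<open>a > 0\<close> D_eq[OF r] \<open>r \<le> \<rho>\<close>, of \<mu>]
    by (intro add_mono) auto
  finally have "pressure_PMF d \<beta> a \<alpha> \<mu> \<ge> ereal (qbar d \<beta> \<alpha> / \<beta>)
      - (ereal ((s - \<alpha>) * r - qbar d \<beta> s / \<beta> + qbar d \<beta> \<alpha> / \<beta>) + ereal (a / 2 * \<rho>\<^sup>2 - \<mu> * \<rho>))"
    unfolding pressure_PMF_def by (intro ereal_minus_mono order_refl)
  then show ?thesis by (simp add: algebra_simps)
qed

section \<open>The density equation of the ideal gas\<close>

text \<open>
  The intermediate value theorem on \<open>[0, 1)\<close>. If the series does not converge to at most \<open>R\<close> at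
  \<open>1\<close>, some partial sum exceeds \<open>R\<close> there, hence also at some \<open>w < 1\<close>, as partial sums are
  polynomials.
\<close>

lemma power_series_attains:
  fixes c :: "nat \<Rightarrow> real"
  assumes c: "\<And>k. 0 \<le> c k" "\<And>k. c k \<le> B" "c 0 = 0" and "R > 0"
  obtains (boundary) r where "c sums r" "r \<le> R"
    | (interior) z where "0 < z" "z < 1" "(\<lambda>k. c k * z ^ k) sums R"
proof (cases "\<forall>n. (\<Sum>k<n. c k) \<le> R")
  case True
  then have "summable c"
    by (intro bounded_imp_summable[of c R])
       (use c in \<open>auto simp: lessThan_Suc_atMost[symmetric] simp del: sum.lessThan_Suc\<close>)
  moreover have "suminf c \<le> R"
    using True \<open>summable c\<close> by (intro suminf_le_const) auto
  ultimately show thesis using boundary summable_sums by blast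
next
  case False
  then obtain n where n: "R < (\<Sum>k<n. c k)" by (auto simp: not_le)
  have summable: "summable (\<lambda>k. c k * z ^ k)" if "0 \<le> z" "z < 1" for z
  proof (rule summable_comparison_test')
    show "summable (\<lambda>k. B * z ^ k)"
      using that by (intro summable_mult summable_geometric) simp
    show "norm (c k * z ^ k) \<le> B * z ^ k" for k
      using that c by (simp add: mult_right_mono)
  qed
  have "((\<lambda>z. \<Sum>k<n. c k * z ^ k) \<longlongrightarrow> (\<Sum>k<n. c k * 1 ^ k)) (at_left 1)"
    by (intro tendsto_intros)
  then have "\<forall>\<^sub>F z in at_left 1. R < (\<Sum>k<n. c k * z ^ k)"
    using n by (intro order_tendstoD) auto
  moreover have "\<forall>\<^sub>F z in at_left (1::real). z \<in> {0<..<1}"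
    by (rule eventually_at_left_real) simp
  ultimately have "\<forall>\<^sub>F z in at_left 1. R < (\<Sum>k<n. c k * z ^ k) \<and> z \<in> {0<..<1}"
    by (rule eventually_conj)
  then obtain w where w: "R < (\<Sum>k<n. c k * w ^ k)" "0 < w" "w < 1"
    using eventually_happens[of _ "at_left (1::real)"] by auto
  define g where "g z = (\<Sum>k. c k * z ^ k)" for z
  have "R \<le> g w"
  proof -
    have "(\<Sum>k<n. c k * w ^ k) \<le> g w"
      unfolding g_def using w c(1) by (intro sum_le_suminf summable) auto
    with w(1) show ?thesis by simp
  qed
  moreover have g0: "g 0 = 0"
    using c(3) by (simp only: g_def powser_zero)
  moreover have "isCont g z" if "0 \<le> z" "z \<le> w" for z
    unfolding g_def using that w
    by (intro isCont_powser[where K = "(w + 1) / 2"] summable) auto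
  ultimately obtain z where z: "0 \<le> z" "z \<le> w" "g z = R"
    using IVT[of g 0 R w] \<open>R > 0\<close> w by auto
  have "z \<noteq> 0" using z g0 \<open>R > 0\<close> by auto
  show thesis
  proof (rule interior)
    show "0 < z" "z < 1" using z w \<open>z \<noteq> 0\<close> by auto
    show "(\<lambda>k. c k * z ^ k) sums R"
      using summable_sums[OF summable[of z]] z w by (simp add: g_def)
  qed
qed

text \<open>
  The density is a power series in the fugacity \<open>exp (\<beta>s)\<close>. Its value \<open>r\<close> at \<open>s = 0\<close> is the
  critical density. The case \<open>s = 0\<close> is the regime where \<open>\<rho>\<close> is at least this density; the
  remaining \<open>r = \<rho>\<close> is the solvable density equation below it.
\<close>

lemma ideal_gas_density:
  assumes "\<beta> > 0" "\<rho> > 0"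
  obtains s r where "s \<le> 0" "(\<lambda>k. real k * q d \<beta> s k) sums r" "r \<le> \<rho>" "s = 0 \<or> r = \<rho>"
proof -
  define c where "c k = real k * q d \<beta> 0 k" for k
  define B where "B = 1 / (4 * pi * \<beta>) powr (real d / 2)"
  have c_le: "c k \<le> B" for k
  proof (cases "k = 0")
    case False
    then have "1 \<le> real k powr (real d / 2)" by (intro ge_one_powr_ge_zero) auto
    moreover have "c k = B / real k powr (real d / 2)"
      using False by (simp add: c_def q_def B_def powr_add)
    moreover have "B \<ge> 0" by (simp add: B_def)
    ultimately show ?thesis by (simp add: divide_le_eq mult_le_cancel_left1)
  qed (simp add: c_def B_def)
  have "c k \<ge> 0" for k by (simp add: c_def q_nonneg)
  from power_series_attains[of c B \<rho>, OF this c_le _ \<open>\<rho> > 0\<close>] consider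
      (boundary) r where "c sums r" "r \<le> \<rho>"
    | (interior) z where "0 < z" "z < 1" "(\<lambda>k. c k * z ^ k) sums \<rho>"
    by (auto simp: c_def)
  then show thesis
  proof cases
    case (boundary r)
    then show thesis using that[of 0 r] by (simp add: c_def[abs_def])
  next
    case (interior z)
    define s where "s = ln z / \<beta>"
    have "c k * z ^ k = real k * q d \<beta> s k" for k
    proof -
      have "z ^ k = exp (\<beta> * s * real k)"
        using interior \<open>\<beta> > 0\<close> by (simp add: s_def exp_of_nat2_mult)
      then show ?thesis by (simp add: c_def q_shift[of d \<beta> s k 0])
    qed
    moreover have "s \<le> 0"
      using interior \<open>\<beta> > 0\<close> by (simp add: s_def divide_nonpos_pos)
    ultimately show thesis using that[of s \<rho>] interior(3) by simp
  qed
qed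

section \<open>The free energy of the PMF model\<close>

lemma free_energy_PMF_ge:
  assumes "d \<ge> 1" "\<beta> > 0" "a > 0"
  shows "free_energy_PMF d \<beta> a \<rho> \<ge> free_energy d \<beta> \<rho> + ereal (a / 2 * \<rho>\<^sup>2)"
proof -
  have "ereal (s * \<rho>) - pressure d \<beta> s \<le> free_energy_PMF d \<beta> a \<rho> - ereal (a / 2 * \<rho>\<^sup>2)" for s
  proof (cases "s \<le> 0")
    case True
    \<comment> \<open>\<open>\<mu> = a\<rho>\<close> maximises \<open>\<mu>\<rho> - \<mu>\<^sup>2 / (2a)\<close>, with value \<open>a\<rho>\<^sup>2 / 2\<close>.\<close>
    have "ereal ((a * \<rho> + s) * \<rho>) - ereal (qbar d \<beta> s / \<beta> + (a * \<rho>)\<^sup>2 / (2 * a))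
        \<le> ereal ((a * \<rho> + s) * \<rho>) - pressure_PMF d \<beta> a s (a * \<rho>)"
      using assms True by (intro ereal_minus_mono pressure_PMF_le) auto
    also have "\<dots> \<le> free_energy_PMF d \<beta> a \<rho>"
      unfolding free_energy_PMF_def using True by (intro SUP_upper2[of "(a * \<rho>, s)"]) auto
    finally have "ereal ((a * \<rho> + s) * \<rho>) - ereal (qbar d \<beta> s / \<beta> + (a * \<rho>)\<^sup>2 / (2 * a))
        \<le> free_energy_PMF d \<beta> a \<rho>" .
    moreover have "(a * \<rho> + s) * \<rho> - (qbar d \<beta> s / \<beta> + (a * \<rho>)\<^sup>2 / (2 * a))
        = s * \<rho> - qbar d \<beta> s / \<beta> + a / 2 * \<rho>\<^sup>2"
      using assms by (simp add: field_simps power2_eq_square)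
    ultimately show ?thesis
      using True by (simp add: pressure_def ereal_le_minus)
  qed (simp add: pressure_def)
  then have "free_energy d \<beta> \<rho> \<le> free_energy_PMF d \<beta> a \<rho> - ereal (a / 2 * \<rho>\<^sup>2)"
    unfolding free_energy_def by (intro SUP_least)
  then show ?thesis by (simp add: ereal_le_minus)
qed

lemma free_energy_PMF_le:
  assumes "d \<ge> 1" "\<beta> > 0" "a > 0" "\<rho> > 0"
  shows "free_energy_PMF d \<beta> a \<rho> \<le> free_energy d \<beta> \<rho> + ereal (a / 2 * \<rho>\<^sup>2)"
proof -
  obtain s r where s: "s \<le> 0" "(\<lambda>k. real k * q d \<beta> s k) sums r" "r \<le> \<rho>" "s = 0 \<or> r = \<rho>"
    using ideal_gas_density[OF \<open>\<beta> > 0\<close> \<open>\<rho> > 0\<close>] .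
  have "free_energy_PMF d \<beta> a \<rho> \<le> ereal (s * \<rho> - qbar d \<beta> s / \<beta>) + ereal (a / 2 * \<rho>\<^sup>2)"
    unfolding free_energy_PMF_def
  proof (rule SUP_least, clarify)
    fix \<mu> \<alpha> :: real assume "\<alpha> \<le> 0"
    then have le_0: "(\<alpha> - s) * (\<rho> - r) \<le> 0"
      using s by (auto simp: mult_nonpos_nonneg)
    have "ereal ((\<mu> + \<alpha>) * \<rho>) - pressure_PMF d \<beta> a \<alpha> \<mu>
        \<le> ereal ((\<mu> + \<alpha>) * \<rho>) - ereal ((\<alpha> - s) * r + qbar d \<beta> s / \<beta> + \<mu> * \<rho> - a / 2 * \<rho>\<^sup>2)"
      using assms s by (intro ereal_minus_mono pressure_PMF_ge) auto
    also have "\<dots> \<le> ereal (s * \<rho> - qbar d \<beta> s / \<beta>) + ereal (a / 2 * \<rho>\<^sup>2)"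
      using le_0 by (simp add: algebra_simps)
    finally show "ereal ((\<mu> + \<alpha>) * \<rho>) - pressure_PMF d \<beta> a \<alpha> \<mu>
        \<le> ereal (s * \<rho> - qbar d \<beta> s / \<beta>) + ereal (a / 2 * \<rho>\<^sup>2)" .
  qed
  also have "ereal (s * \<rho> - qbar d \<beta> s / \<beta>) \<le> free_energy d \<beta> \<rho>"
    unfolding free_energy_def using s(1) by (intro SUP_upper2[of s]) (auto simp: pressure_def)
  finally show ?thesis by (simp add: add_right_mono)
qed

theorem proposition3p8:
  fixes d :: nat and \<beta> a \<rho> :: real
  assumes "d \<ge> 1" and "\<beta> > 0" and "a > 0" and "\<rho> > 0"
  shows "free_energy_PMF d \<beta> a \<rho> = free_energy d \<beta> \<rho> + ereal (a / 2 * \<rho>\<^sup>2)"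
  using assms by (intro antisym free_energy_PMF_le free_energy_PMF_ge)

end
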